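(* Let $(A,\le)$ be a partially ordered set and let $a\in A$. Then the induced relation $\le_a$ is a partial order (reflexive, transitive and antisymmetric) on the free monoid $A_a^*$.
   Context: All order relations are reflexive. For a set $X$, $X^*$ denotes the free monoid of finite words over $X$ (including the empty word), and $|w|$ is the length of a word $w$; for $n\in\mathbb{N}$, $A^n$ is identified with the words of length $n$ over $A$ and carries the product order ($v\le w$ iff $v_i\le w_i$ in $A$ for all $i=1,\dots,n$, where $v_i$ is the $i$-th letter). For $a\in A$ put $A_a=A\setminus\{a\}$ and $A_a^*=(A\setminus\{a\})^*$. A word $w'\in A^*$ is an $a$-extension of a word $w\in A_a^*$ if $w'$ is obtained from $w$ by inserting finitely many (possibly zero) copies of the letter $a$ at arbitrary positions (equivalently, deleting all occurrences of $a$ from $w'$ yields $w$). The induced relation $\le_a$ on $A_a^*$ is defined by: $v\le_a w$ iff there exist an $a$-extension $v'$ of $v$ and an $a$-extension $w'$ of $w$ with $|v'|=|w'|=n$ for some $n$ and $v'_i\le w'_i$ in $A$ for every $i=1,\dots,n$. *)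

theory Defs
  imports Main
begin

inductive is_extension :: "'a \<Rightarrow> 'a list \<Rightarrow> 'a list \<Rightarrow> bool" for a :: 'a and w :: "'a list"
  where
    none: "is_extension a w w"
  | insert: "is_extension a w (x @ y) \<Longrightarrow> is_extension a w (x @ a # y)"

lemma is_extension_append_left:
  "is_extension a w w' \<Longrightarrow> is_extension a (u @ w) (u @ w')"
proof (induction rule: is_extension.induct)
  case none
  show ?case by (rule is_extension.none)
next
  case (insert x y)
  then show ?case
    using is_extension.insert[of a "u @ w" "u @ x" y] by simp
qed

lemma is_extension_iff_filter:
  assumes "a \<notin> set w"
  shows "is_extension a w w' \<longleftrightarrow> filter (\<lambda>b. b \<noteq> a) w' = w"
proof
  assume "is_extension a w w'"
  then show "filter (\<lambda>b. b \<noteq> a) w' = w"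
    using assms by induction (auto simp: filter_id_conv)
next
  have "is_extension a (filter (\<lambda>b. b \<noteq> a) w') w'"
  proof (induction w')
    case Nil
    show ?case by (simp add: is_extension.none)
  next
    case (Cons b w')
    show ?case
    proof (cases "b = a")
      case True
      then show ?thesis
        using Cons is_extension.insert[of a _ "[]" w'] by simp
    next
      case False
      then show ?thesis
        using is_extension_append_left[OF Cons, of "[b]"] by simp
    qed
  qed
  then show "filter (\<lambda>b. b \<noteq> a) w' = w \<Longrightarrow> is_extension a w w'" by simp
qed

text \<open>Posets are pairs of a carrier set \<open>A\<close> and a relation \<open>r\<close>, and the free monoid
  \<open>A\<^sub>a\<^sup>*\<close> on \<open>A\<^sub>a = A - {a}\<close> is \<^term>\<open>lists (A - {a})\<close>.\<close>

definition induced_order :: "'a set \<Rightarrow> ('a \<times> 'a) set \<Rightarrow> 'a \<Rightarrow> ('a list \<times> 'a list) set"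
  where
    "induced_order A r a =
      {(v, w). v \<in> lists (A - {a}) \<and> w \<in> lists (A - {a}) \<and>
        (\<exists>v' w' n. is_extension a v v' \<and> is_extension a w w' \<and>
          length v' = n \<and> length w' = n \<and> (\<forall>i<n. (v' ! i, w' ! i) \<in> r))}"

end

theory Submission
  imports Defs
begin

text \<open>Transitivity: two \<open>a\<close>-extensions of the middle word have a common \<open>a\<close>-extension, and every
  copy of \<open>a\<close> added to reach it can be added to the outer word at the same position.
  Antisymmetry: passing to a larger word cannot decrease the number of letters strictly above \<open>a\<close>
  nor increase the number of letters strictly below \<open>a\<close>. If \<open>v \<le>\<^sub>a w \<le>\<^sub>a v\<close> these numbers agree,
  so no letter of \<open>v\<close> or \<open>w\<close> is paired with an inserted \<open>a\<close>; hence \<open>v\<close> and \<open>w\<close> are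
  comparable letter by letter in both directions.\<close>

text \<open>On words without \<open>a\<close>, being an extension is the same as returning to the
  word when \<open>a\<close> is deleted. Stating comparability by \<open>list_all2\<close> opens it
  to induction on pairs of words.\<close>

lemma induced_order_iff:
  "(v, w) \<in> induced_order A r a \<longleftrightarrow>
    v \<in> lists (A - {a}) \<and> w \<in> lists (A - {a}) \<and>
    (\<exists>v' w'. filter (\<lambda>b. b \<noteq> a) v' = v \<and> filter (\<lambda>b. b \<noteq> a) w' = w \<and>
      list_all2 (\<lambda>b c. (b, c) \<in> r) v' w')"
proof (cases "v \<in> lists (A - {a}) \<and> w \<in> lists (A - {a})")
  case True
  then have "a \<notin> set v" "a \<notin> set w"
    by auto
  with True show ?thesis
    by (simp add: induced_order_def is_extension_iff_filter list_all2_conv_all_nth) metis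
qed (auto simp: induced_order_def)

text \<open>Merge \<open>w1\<close> and \<open>w2\<close> from the left. A leading \<open>a\<close>
  of one is consumed alone, its partner in the outer word being paired with a new \<open>a\<close>
  in the opposite outer word; equal letters are consumed together, by transitivity.\<close>

lemma list_all2_compose_extensions:
  assumes "trans r"
    and "list_all2 (\<lambda>b c. (b, c) \<in> r) v w1" "list_all2 (\<lambda>b c. (b, c) \<in> r) w2 u"
    and "filter (\<lambda>b. b \<noteq> a) w1 = filter (\<lambda>b. b \<noteq> a) w2"
  shows "\<exists>v' u'. filter (\<lambda>b. b \<noteq> a) v' = filter (\<lambda>b. b \<noteq> a) v \<and>
    filter (\<lambda>b. b \<noteq> a) u' = filter (\<lambda>b. b \<noteq> a) u \<and> list_all2 (\<lambda>b c. (b, c) \<in> r) v' u'"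
  using assms(2-)
proof (induction "length w1 + length w2" arbitrary: v w1 w2 u rule: less_induct)
  case less
  \<comment> \<open>If neither word starts with \<open>a\<close>, equality after deletion forces
    both to be empty or to share their first letter.\<close>
  consider (left) w1' where "w1 = a # w1'" | (right) w2' where "w2 = a # w2'"
    | (nil) "w1 = []" "w2 = []"
    | (both) b w1' w2' where "b \<noteq> a" "w1 = b # w1'" "w2 = b # w2'"
    using less.prems(3) by (cases w1; cases w2) (auto split: if_splits)
  then show ?case
  proof cases
    case left
    then obtain b v1 where v: "v = b # v1" "(b, a) \<in> r" "list_all2 (\<lambda>b c. (b, c) \<in> r) v1 w1'"
      using less.prems(1) by (auto simp: list_all2_Cons2)
    obtain v' u' where "filter (\<lambda>b. b \<noteq> a) v' = filter (\<lambda>b. b \<noteq> a) v1"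
      "filter (\<lambda>b. b \<noteq> a) u' = filter (\<lambda>b. b \<noteq> a) u" "list_all2 (\<lambda>b c. (b, c) \<in> r) v' u'"
      using less.hyps[of w1' w2 v1 u] less.prems v left by auto
    then show ?thesis
      using v by (intro exI[of _ "b # v'"] exI[of _ "a # u'"]) simp
  next
    case right
    then obtain c u1 where u: "u = c # u1" "(a, c) \<in> r" "list_all2 (\<lambda>b c. (b, c) \<in> r) w2' u1"
      using less.prems(2) by (auto simp: list_all2_Cons1)
    obtain v' u' where "filter (\<lambda>b. b \<noteq> a) v' = filter (\<lambda>b. b \<noteq> a) v"
      "filter (\<lambda>b. b \<noteq> a) u' = filter (\<lambda>b. b \<noteq> a) u1" "list_all2 (\<lambda>b c. (b, c) \<in> r) v' u'"
      using less.hyps[of w1 w2' v u1] less.prems u right by auto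
    then show ?thesis
      using u by (intro exI[of _ "a # v'"] exI[of _ "c # u'"]) simp
  next
    case nil
    then show ?thesis
      using less.prems by (intro exI[of _ "[]"]) simp
  next
    case both
    obtain d v1 where v: "v = d # v1" "(d, b) \<in> r" "list_all2 (\<lambda>b c. (b, c) \<in> r) v1 w1'"
      using less.prems(1) both by (auto simp: list_all2_Cons2)
    obtain c u1 where u: "u = c # u1" "(b, c) \<in> r" "list_all2 (\<lambda>b c. (b, c) \<in> r) w2' u1"
      using less.prems(2) both by (auto simp: list_all2_Cons1)
    have "(d, c) \<in> r"
      using \<open>trans r\<close> u(2) v(2) by (meson transD)
    obtain v' u' where "filter (\<lambda>b. b \<noteq> a) v' = filter (\<lambda>b. b \<noteq> a) v1"
      "filter (\<lambda>b. b \<noteq> a) u' = filter (\<lambda>b. b \<noteq> a) u1" "list_all2 (\<lambda>b c. (b, c) \<in> r) v' u'"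
      using less.hyps[of w1' w2' v1 u1] less.prems u v both by auto
    then show ?thesis
      using u v \<open>(d, c) \<in> r\<close> by (intro exI[of _ "d # v'"] exI[of _ "c # u'"]) simp
  qed
qed

text \<open>Leaving out \<open>a\<close> itself makes the count the same for a word and all its
  \<open>a\<close>-extensions, even though \<open>r\<close> may relate \<open>a\<close> to
  itself.\<close>

definition num_above :: "('a \<times> 'a) set \<Rightarrow> 'a \<Rightarrow> 'a list \<Rightarrow> nat"
  where "num_above r a w = length (filter (\<lambda>b. b \<noteq> a \<and> (a, b) \<in> r) w)"

definition num_below :: "('a \<times> 'a) set \<Rightarrow> 'a \<Rightarrow> 'a list \<Rightarrow> nat"
  where "num_below r a w = length (filter (\<lambda>b. b \<noteq> a \<and> (b, a) \<in> r) w)"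

lemma num_above_filter [simp]: "num_above r a (filter (\<lambda>b. b \<noteq> a) w) = num_above r a w"
  unfolding num_above_def by (simp add: conj_commute)

lemma num_below_filter [simp]: "num_below r a (filter (\<lambda>b. b \<noteq> a) w) = num_below r a w"
  unfolding num_below_def by (simp add: conj_commute)

text \<open>If \<open>b\<close> is strictly above \<open>a\<close> and \<open>b\<close> \<le>
  \<open>c\<close>, then \<open>c\<close> is above \<open>a\<close> by transitivity and differs from
  \<open>a\<close> by antisymmetry.\<close>

lemma num_above_mono:
  assumes "trans r" "antisym r" "list_all2 (\<lambda>b c. (b, c) \<in> r) v w"
  shows "num_above r a v \<le> num_above r a w"
  using assms(3)
  by induction (use assms(1,2) in \<open>auto simp: num_above_def dest: transD antisymD\<close>)

lemma num_below_antimono: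
  assumes "trans r" "antisym r" "list_all2 (\<lambda>b c. (b, c) \<in> r) v w"
  shows "num_below r a w \<le> num_below r a v"
  using assms(3)
  by induction (use assms(1,2) in \<open>auto simp: num_below_def dest: transD antisymD\<close>)

text \<open>A pair (\<open>a\<close>, \<open>c\<close>) with \<open>c\<close> \<noteq>
  \<open>a\<close> would raise \<open>num_above\<close>, and a pair (\<open>b\<close>,
  \<open>a\<close>) with \<open>b\<close> \<noteq> \<open>a\<close> would lower
  \<open>num_below\<close>. Hence \<open>a\<close> occurs at the same positions in both words, and
  deleting it keeps the pairing.\<close>

lemma list_all2_filter_if_num_eq:
  assumes "trans r" "antisym r" "list_all2 (\<lambda>b c. (b, c) \<in> r) v w"
    and "num_above r a v = num_above r a w" "num_below r a v = num_below r a w"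
  shows "list_all2 (\<lambda>b c. (b, c) \<in> r) (filter (\<lambda>b. b \<noteq> a) v) (filter (\<lambda>b. b \<noteq> a) w)"
  using assms(3-)
proof induction
  case (Cons b v c w)
  \<comment> \<open>Heads and tails change each count in the same direction, so equality for the
    whole words forces equality for the tails and for the heads.\<close>
  have above: "num_above r a v \<le> num_above r a w"
    using num_above_mono assms(1,2) Cons.hyps(2) .
  have below: "num_below r a w \<le> num_below r a v"
    using num_below_antimono assms(1,2) Cons.hyps(2) .
  have "(a, b) \<in> r \<Longrightarrow> (a, c) \<in> r" "(c, a) \<in> r \<Longrightarrow> (b, a) \<in> r"
    using \<open>trans r\<close> Cons.hyps(1) by (meson transD)+
  moreover have "b = c" if "b = a \<and> (c, a) \<in> r \<or> c = a \<and> (a, b) \<in> r"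
    using \<open>antisym r\<close> Cons.hyps(1) that by (auto dest: antisymD)
  ultimately have "num_above r a v = num_above r a w" "num_below r a v = num_below r a w"
    "b = a \<longleftrightarrow> c = a"
    using Cons.prems Cons.hyps(1) above below
    by (auto simp: num_above_def num_below_def split: if_splits)
  then show ?case
    using Cons by simp
qed simp

theorem theorem2p2:
  fixes A :: "'a set" and r :: "('a \<times> 'a) set" and a :: 'a
  assumes "partial_order_on A r" and "a \<in> A"
  shows "partial_order_on (lists (A - {a})) (induced_order A r a)"
proof -
  have refl: "refl_on A r" and tr: "trans r" and anti: "antisym r"
    using assms(1) by (auto simp: partial_order_on_def preorder_on_def)
  have "induced_order A r a \<subseteq> lists (A - {a}) \<times> lists (A - {a})"
    by (auto simp: induced_order_def)
  moreover have "refl_on (lists (A - {a})) (induced_order A r a)"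
  proof (rule refl_onI)
    fix w assume w: "w \<in> lists (A - {a})"
    then have "filter (\<lambda>b. b \<noteq> a) w = w" "list_all2 (\<lambda>b c. (b, c) \<in> r) w w"
      using refl by (auto simp: filter_id_conv list_all2_same dest: refl_onD)
    with w show "(w, w) \<in> induced_order A r a"
      unfolding induced_order_iff by blast
  qed
  moreover have "trans (induced_order A r a)"
  proof (rule transI)
    fix v w u assume "(v, w) \<in> induced_order A r a" "(w, u) \<in> induced_order A r a"
    then show "(v, u) \<in> induced_order A r a"
      unfolding induced_order_iff using list_all2_compose_extensions[OF tr, where a = a] by metis
  qed
  moreover have "antisym (induced_order A r a)"
  proof (rule antisymI)
    \<comment> \<open>The counts are compared on the witnessing extensions and carried over to
      \<open>v\<close> and \<open>w\<close> by invariance under deletion of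
      \<open>a\<close>.\<close>
    have mono: "num_above r a v \<le> num_above r a w \<and> num_below r a w \<le> num_below r a v"
      if "(v, w) \<in> induced_order A r a" for v w
      using that num_above_mono[OF tr anti] num_below_antimono[OF tr anti]
      unfolding induced_order_iff by (metis num_above_filter num_below_filter)
    \<comment> \<open>The two comparisons may use unrelated extensions; only the equality of the
      counts links them.\<close>
    have pointwise: "list_all2 (\<lambda>b c. (b, c) \<in> r) v w"
      if "(v, w) \<in> induced_order A r a" "(w, v) \<in> induced_order A r a" for v w
    proof -
      have "num_above r a v = num_above r a w" "num_below r a v = num_below r a w"
        using mono that by (simp_all add: order_antisym)
      then show ?thesis
        using that(1) list_all2_filter_if_num_eq[OF tr anti, where a = a]
        unfolding induced_order_iff by (metis num_above_filter num_below_filter)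
    qed
    fix v w assume "(v, w) \<in> induced_order A r a" "(w, v) \<in> induced_order A r a"
    then show "v = w"
      using pointwise[of v w] pointwise[of w v] anti
      by (auto simp: list_all2_conv_all_nth intro!: nth_equalityI dest: antisymD)
  qed
  ultimately show ?thesis
    by (simp add: partial_order_on_def preorder_on_def)
qed

end
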